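(* Let $U\subset C^1$ be open, let $f:U\to\mathbb{R}^n$ be $C^1_F$-smooth with property (e), let $\bar\phi\in X$ be a stationary point of the semiflow generated by $x'(t)=f(x_t)$ on $X=\{\phi\in U:\phi'(0)=f(\phi)\}$, let $a>0$, and let $\bar\beta>\bar\gamma>0$, $c_u>0$ and the $C^1_F$-submanifold $W^u$ of $C^1$ be as described in the context. Then the following holds. (i) Every $\phi\in W^u$ is a solution of $x'(t)=f(x_t)$ on $(-\infty,0]$, with $\phi_s\to\bar\phi$ as $s\to-\infty$, and for all $s\le0$, $$|\phi(s)-\bar\phi(0)|\le c_ue^{\bar\beta s}|\phi-\bar\phi|_{a,1}\quad\text{and}\quad|\phi'(s)|\le c_ue^{\bar\beta s}|\phi-\bar\phi|_{a,1}.$$ (ii) For every $\psi\in X$ which is a solution of $x'(t)=f(x_t)$ on $(-\infty,0]$ with $$\sup_{s\le0}e^{-\bar\gamma s}|\psi(s)-\bar\phi(0)|<\infty\quad\text{and}\quad\sup_{s\le0}e^{-\bar\gamma s}|\psi'(s)|<\infty$$ there exists $s(\psi)\le0$ with $\psi_s\in W^u$ for all $s\le s(\psi)$.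
   Context: Spaces. $C$, $C^1$ are the Fréchet spaces of continuous, respectively continuously differentiable, maps $(-\infty,0]\to\mathbb{R}^n$ with locally uniform convergence of maps, respectively of maps and derivatives. For $d>0$, $C_d$ and $C^1_d$ are the Banach spaces of continuous, respectively continuously differentiable, maps $[-d,0]\to\mathbb{R}^n$, the latter with $|\phi|_{d,1}=\max|\phi|+\max|\phi'|$. $R_{d,1}:C^1\to C^1_d$ is restriction to $[-d,0]$, and $P_{d,1}:C^1_d\to C^1$ is $(P_{d,1}\phi)(s)=\phi(s)$ on $[-d,0]$, $(P_{d,1}\phi)(s)=\phi(-d)+(s+d)\phi'(-d)$ for $s<-d$. For $a>0$, $B_a$ is the Banach space of all $\phi\in C$ with $|\phi|_a=\sup_{t\le0}|\phi(t)|e^{at}<\infty$, and $B^1_a$ is the Banach space of all $\phi\in C^1$ with $\phi,\phi'\in B_a$, with norm $|\phi|_{a,1}=|\phi|_a+|\phi'|_a$. $j_1:B^1_a\to C^1$ is the (continuous linear) inclusion and $R_{a,d,1}=R_{d,1}\circ j_1$. Segments: $x_t(s)=x(t+s)$; in the statement and in equations posed in $C^1$ or $B^1_a$ they are defined for all $s\le0$. A solution on an interval $I$ of $x'(t)=g(x_t)$, $g$ defined on an open set $O$ of $C^1$ or $B^1_a$, is a map $x$ on $(-\infty,0]+I$ with $x_t\in O$ for $t\in I$, differentiable on $I$, and satisfying the equation there. $C^1_F$-smoothness. For topological vector spaces $E,W$, $L_c(E,W)$ (continuous linear maps) carries the topology $\beta$ of uniform convergence on bounded sets. A continuous map $h:E\supset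 O\to W$, $O$ open, is $C^1_F$-smooth if all directional derivatives $Dh(u)v=\lim_{0\ne t\to0}\frac1t(h(u+tv)-h(u))$ exist, each $Dh(u)$ is linear and continuous, and $O\ni u\mapsto Dh(u)\in L_c(E,W)$ is $\beta$-continuous. A subset $M$ of a Fréchet space $F=G\oplus H$ ($G,H$ closed) is a $C^1_F$-submanifold if each $m\in M$ has an open neighbourhood $O$ in $F$ with an injective $C^1_F$-map $K$ of $O$ onto an open set $W\subset F$, with $C^1_F$-smooth inverse, such that $K(M\cap O)=W\cap G$. $T_mM$ is the set of tangent vectors $c'(0)$ of continuously differentiable curves in $M$ through $c(0)=m$. Property (e) of $f$: each $Df(\phi):C^1\to\mathbb{R}^n$, $\phi\in U$, has a linear extension $D_ef(\phi):C\to\mathbb{R}^n$ such that $U\times C\ni(\phi,\chi)\mapsto D_ef(\phi)\chi\in\mathbb{R}^n$ is continuous. Semiflow. The maximal solutions $x^\phi$ on $[0,t_\phi)$ of $x'(t)=f(x_t)$ with $x_0=\phi\in X$ define a continuous semiflow $\Sigma(t,\phi)=x^\phi_t$, $0\le t<t_\phi$, on $X$. $\bar\phi\in X$ is a stationary point if $\Sigma(t,\bar\phi)=\bar\phi$ for all $t\ge0$; then $\bar\phi$ is constant. Choice of $N$, $d$, $U_d$. Fix an open neighbourhood $N\subset U$ of $\bar\phi$ and $d>0$ such that $f(\chi)=f(\psi)$ for all $\chi,\psi\in N$ with $\chi=\psi$ on $[-d,0]$ (these are known to exist). Put $\bar\phi_d=R_{d,1}\bar\phi$, fix an open neighbourhood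 $U_d$ of $\bar\phi_d$ in $C^1_d$ with $P_{d,1}U_d\subset N$, and let $f_d:U_d\to\mathbb{R}^n$, $f_d(\phi)=f(P_{d,1}\phi)$. Its derivative $Df_d(\bar\phi_d)$ has a continuous linear extension $D_ef_d(\bar\phi_d):C_d\to\mathbb{R}^n$. Let $C_{d,u}$ be the finite-dimensional linear unstable space of the strongly continuous semigroup on $C_d$ given by the solutions of $v'(t)=D_ef_d(\bar\phi_d)v_t$ (spectral subspace for the part of the spectrum of the generator with positive real part). Each $\chi\in C_{d,u}$ uniquely determines an analytic solution $v^\chi:\mathbb{R}\to\mathbb{R}^n$ of this equation on $\mathbb{R}$ with $v^\chi|_{[-d,0]}=\chi$ and all segments on $[-d,0]$ in $C_{d,u}$. Put $Y_u=\{v^\chi|_{(-\infty,0]}:\chi\in C_{d,u}\}\subset B^1_a$. Local unstable manifold in $B^1_a$. Let $U_a=j_1^{-1}(N)\cap R_{a,d,1}^{-1}(U_d)$, $f_a:U_a\to\mathbb{R}^n$, $f_a(\phi)=f(j_1\phi)$, and $X_a=\{\phi\in U_a:\phi'(0)=f_a(\phi)\}$, a $C^1_F$-submanifold of $B^1_a$. $W^u_a\subset X_a$ denotes the (known) local unstable manifold at $\bar\phi\in W^u_a$ of the semiflow of $x'(t)=f_a(x_t)$ on $X_a$: a $C^1_F$-submanifold of $B^1_a$ with $T_{\bar\phi}W^u_a=Y_u$, consisting of $\phi\in X_a$ which are solutions of $x'(t)=f_a(x_t)$ on $(-\infty,0]$ with $\phi_s\to\bar\phi$ as $s\to-\infty$,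 and such that there are $\bar\beta>\bar\gamma>0$ and $c_u>0$ with (I) $|\phi_s-\bar\phi|_{a,1}\le c_ue^{\bar\beta s}|\phi-\bar\phi|_{a,1}$ for all $\phi\in W^u_a$, $s\le0$; (II) for every solution $\psi\in B^1_a$ of $x'(t)=f_a(x_t)$ on $(-\infty,0]$ with $\sup_{s\le0}|\psi_s-\bar\phi|_{a,1}e^{-\bar\gamma s}<\infty$ there is $s_\psi\le0$ with $\psi_s\in W^u_a$ for all $s\le s_\psi$. Definition of $W^u$. For some $\epsilon>0$ let $Y_u(\epsilon)=\{\phi\in Y_u:|\phi|_{a,1}<\epsilon\}$ and let $w^u_a:Y_u(\epsilon)\to B^1_a$ be a $C^1_F$-map (obtained from a manifold chart of $W^u_a$ at $\bar\phi$) with $w^u_a(0)=\bar\phi$, $w^u_a(Y_u(\epsilon))$ an open subset of $W^u_a$, $Dw^u_a(0)\eta=\eta$ for all $\eta\in Y_u$, and with $\epsilon$ so small that $W^u=j_1w^u_a(Y_u(\epsilon))$ is a $C^1_F$-submanifold of the Fréchet space $C^1$ with $T_{\bar\phi}W^u=Y_u$. *)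

theory Defs
  imports "HOL-Complex_Analysis.Complex_Analysis" "HOL-Library.Function_Algebras"
begin

text \<open>
  The function spaces are rendered as linear subspaces of the type of all maps from
  the reals into a normed space, with the pointwise vector space structure: a map on a closed
  interval \<open>J\<close> is represented by its extension by \<open>0\<close> to the whole line.  A topological vector
  space is given by an abstract topology whose underlying set is such a subspace.
\<close>

instantiation "fun" :: (type, real_vector) real_vector
begin

definition scaleR_fun :: "real \<Rightarrow> ('a \<Rightarrow> 'b) \<Rightarrow> 'a \<Rightarrow> 'b" where
  "scaleR_fun r f = (\<lambda>x. r *\<^sub>R f x)"

instance
  by standard (simp_all add: scaleR_fun_def plus_fun_def fun_eq_iff
      scaleR_add_right scaleR_add_left)

end

section \<open>Topological vector spaces and differentiability\<close>

text \<open>The topology on \<open>S\<close> defined by a family \<open>P\<close> of seminorms.\<close>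

definition seminorm_topology :: "'a::real_vector set \<Rightarrow> ('a \<Rightarrow> real) set \<Rightarrow> 'a topology" where
  "seminorm_topology S P = topology (\<lambda>G. G \<subseteq> S \<and>
     (\<forall>x\<in>G. \<exists>F e. finite F \<and> F \<subseteq> P \<and> e > 0 \<and> {y\<in>S. \<forall>p\<in>F. p (y - x) < e} \<subseteq> G))"

lemma openin_seminorm_topology:
  "openin (seminorm_topology S P) G \<longleftrightarrow> G \<subseteq> S \<and>
     (\<forall>x\<in>G. \<exists>F e. finite F \<and> F \<subseteq> P \<and> e > 0 \<and> {y\<in>S. \<forall>p\<in>F. p (y - x) < e} \<subseteq> G)"
proof -
  define Q where "Q G x F e \<longleftrightarrow> finite F \<and> F \<subseteq> P \<and> e > (0::real) \<and> {y\<in>S. \<forall>p\<in>F. p (y - x) < e} \<subseteq> G"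
    for G x F e
  have "istopology (\<lambda>G. G \<subseteq> S \<and> (\<forall>x\<in>G. \<exists>F e. Q G x F e))"
    unfolding istopology_def
  proof (intro conjI allI impI ballI)
    fix A B x
    assume A: "A \<subseteq> S \<and> (\<forall>x\<in>A. \<exists>F e. Q A x F e)" and B: "B \<subseteq> S \<and> (\<forall>x\<in>B. \<exists>F e. Q B x F e)"
      and x: "x \<in> A \<inter> B"
    obtain F e F' e' where "Q A x F e" "Q B x F' e'"
      using A B x by blast
    then have "Q (A \<inter> B) x (F \<union> F') (min e e')"
      unfolding Q_def by auto
    then show "\<exists>F e. Q (A \<inter> B) x F e" by blast
  next
    fix K x
    assume K: "\<forall>A\<in>K. A \<subseteq> S \<and> (\<forall>x\<in>A. \<exists>F e. Q A x F e)" and x: "x \<in> \<Union>K"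
    then obtain A F e where "A \<in> K" "Q A x F e" by blast
    then have "Q (\<Union>K) x F e" unfolding Q_def by blast
    then show "\<exists>F e. Q (\<Union>K) x F e" by blast
  qed auto
  then show ?thesis
    unfolding seminorm_topology_def Q_def by (simp add: topology_inverse')
qed

lemma topspace_seminorm_topology [simp]: "topspace (seminorm_topology S P) = S"
proof
  show "topspace (seminorm_topology S P) \<subseteq> S"
    using openin_topspace[of "seminorm_topology S P"]
    by (simp only: openin_seminorm_topology)
  have "\<exists>F e. finite F \<and> F \<subseteq> P \<and> (0::real) < e \<and> {y \<in> S. \<forall>p\<in>F. p (y - x) < e} \<subseteq> S" for x
    by (intro exI[of _ "{}"] exI[of _ 1]) auto
  then have "openin (seminorm_topology S P) S"
    unfolding openin_seminorm_topology by blast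
  then show "S \<subseteq> topspace (seminorm_topology S P)"
    by (rule openin_subset)
qed

definition linear_on :: "'a::real_vector set \<Rightarrow> ('a \<Rightarrow> 'b::real_vector) \<Rightarrow> bool" where
  "linear_on S L \<longleftrightarrow> (\<forall>x\<in>S. \<forall>y\<in>S. L (x + y) = L x + L y) \<and> (\<forall>x\<in>S. \<forall>r. L (r *\<^sub>R x) = r *\<^sub>R L x)"

text \<open>Only the values of an element of \<open>Lc E W\<close> on the underlying set of \<open>E\<close> matter.\<close>

definition Lc :: "'a::real_vector topology \<Rightarrow> 'b::real_vector topology \<Rightarrow> ('a \<Rightarrow> 'b) set" where
  "Lc E W = {L. linear_on (topspace E) L \<and> continuous_map E W L}"

definition tvs_bounded :: "'a::real_vector topology \<Rightarrow> 'a set \<Rightarrow> bool" where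
  "tvs_bounded E B \<longleftrightarrow> B \<subseteq> topspace E \<and>
     (\<forall>V. openin E V \<and> 0 \<in> V \<longrightarrow> (\<exists>s>0. \<forall>t\<ge>s. B \<subseteq> (\<lambda>x. t *\<^sub>R x) ` V))"

text \<open>Uniform convergence on bounded sets.\<close>

definition beta_topology ::
  "'a::real_vector topology \<Rightarrow> 'b::real_vector topology \<Rightarrow> ('a \<Rightarrow> 'b) topology" where
  "beta_topology E W = topology (\<lambda>G. G \<subseteq> Lc E W \<and>
     (\<forall>L\<in>G. \<exists>B V. tvs_bounded E B \<and> openin W V \<and> 0 \<in> V \<and>
        {M \<in> Lc E W. \<forall>x\<in>B. M x - L x \<in> V} \<subseteq> G))"

lemma tvs_bounded_Un:
  assumes "tvs_bounded E A" "tvs_bounded E B"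
  shows "tvs_bounded E (A \<union> B)"
  unfolding tvs_bounded_def
proof (intro conjI allI impI)
  show "A \<union> B \<subseteq> topspace E" using assms by (auto simp: tvs_bounded_def)
  fix V assume "openin E V \<and> 0 \<in> V"
  then obtain s s' where "s > 0" "\<forall>t\<ge>s. A \<subseteq> (\<lambda>x. t *\<^sub>R x) ` V"
      "s' > 0" "\<forall>t\<ge>s'. B \<subseteq> (\<lambda>x. t *\<^sub>R x) ` V"
    using assms unfolding tvs_bounded_def by metis
  then show "\<exists>s>0. \<forall>t\<ge>s. A \<union> B \<subseteq> (\<lambda>x. t *\<^sub>R x) ` V"
    by (intro exI[of _ "max s s'"]) auto
qed

lemma openin_beta_topology:
  "openin (beta_topology E W) G \<longleftrightarrow> G \<subseteq> Lc E W \<and>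
     (\<forall>L\<in>G. \<exists>B V. tvs_bounded E B \<and> openin W V \<and> 0 \<in> V \<and>
        {M \<in> Lc E W. \<forall>x\<in>B. M x - L x \<in> V} \<subseteq> G)"
proof -
  define Q where "Q G L B V \<longleftrightarrow> tvs_bounded E B \<and> openin W V \<and> 0 \<in> V \<and>
      {M \<in> Lc E W. \<forall>x\<in>B. M x - L x \<in> V} \<subseteq> G" for G L B V
  have "istopology (\<lambda>G. G \<subseteq> Lc E W \<and> (\<forall>L\<in>G. \<exists>B V. Q G L B V))"
    unfolding istopology_def
  proof (intro conjI allI impI ballI)
    fix S T L
    assume S: "S \<subseteq> Lc E W \<and> (\<forall>L\<in>S. \<exists>B V. Q S L B V)"
      and T: "T \<subseteq> Lc E W \<and> (\<forall>L\<in>T. \<exists>B V. Q T L B V)" and L: "L \<in> S \<inter> T"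
    obtain B V B' V' where "Q S L B V" "Q T L B' V'"
      using S T L by blast
    then have "Q (S \<inter> T) L (B \<union> B') (V \<inter> V')"
      unfolding Q_def by (auto intro: tvs_bounded_Un)
    then show "\<exists>B V. Q (S \<inter> T) L B V" by blast
  next
    fix K L
    assume K: "\<forall>S\<in>K. S \<subseteq> Lc E W \<and> (\<forall>L\<in>S. \<exists>B V. Q S L B V)" and L: "L \<in> \<Union>K"
    then obtain S B V where "S \<in> K" "Q S L B V" by blast
    then have "Q (\<Union>K) L B V" unfolding Q_def by blast
    then show "\<exists>B V. Q (\<Union>K) L B V" by blast
  qed auto
  then show ?thesis
    unfolding beta_topology_def Q_def by (simp add: topology_inverse')
qed

lemma topspace_beta_topology:
  assumes "0 \<in> topspace W"
  shows "topspace (beta_topology E W) = Lc E W"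
proof
  show "topspace (beta_topology E W) \<subseteq> Lc E W"
    using openin_topspace[of "beta_topology E W"] by (simp only: openin_beta_topology)
  have "tvs_bounded E {}" by (auto simp: tvs_bounded_def intro: exI[of _ 1])
  then have "openin (beta_topology E W) (Lc E W)"
    unfolding openin_beta_topology using assms by blast
  then show "Lc E W \<subseteq> topspace (beta_topology E W)"
    by (rule openin_subset)
qed

definition has_dirderiv ::
  "'b topology \<Rightarrow> ('a::real_vector \<Rightarrow> 'b::real_vector) \<Rightarrow> 'a \<Rightarrow> 'a \<Rightarrow> 'b \<Rightarrow> bool" where
  "has_dirderiv W h u v l \<longleftrightarrow> limitin W (\<lambda>t. (1 / t) *\<^sub>R (h (u + t *\<^sub>R v) - h u)) l (at (0::real))"

definition dirderiv ::
  "'b topology \<Rightarrow> ('a::real_vector \<Rightarrow> 'b::real_vector) \<Rightarrow> 'a \<Rightarrow> 'a \<Rightarrow> 'b" where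
  "dirderiv W h u v = (THE l. has_dirderiv W h u v l)"

definition C1F ::
  "'a::real_vector topology \<Rightarrow> 'a set \<Rightarrow> 'b::real_vector topology \<Rightarrow> ('a \<Rightarrow> 'b) \<Rightarrow> bool" where
  "C1F E D W h \<longleftrightarrow> openin E D \<and> continuous_map (subtopology E D) W h \<and>
     (\<forall>u\<in>D. \<forall>v\<in>topspace E. \<exists>l. has_dirderiv W h u v l) \<and>
     (\<forall>u\<in>D. dirderiv W h u \<in> Lc E W) \<and>
     continuous_map (subtopology E D) (beta_topology E W) (dirderiv W h)"

definition C1F_submanifold :: "'a::real_vector topology \<Rightarrow> 'a set \<Rightarrow> bool" where
  "C1F_submanifold F M \<longleftrightarrow> M \<subseteq> topspace F \<and>
     (\<exists>G H. subspace G \<and> closedin F G \<and> subspace H \<and> closedin F H \<and>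
        G \<inter> H = {0} \<and> {g + h | g h. g \<in> G \<and> h \<in> H} = topspace F \<and>
        (\<forall>m\<in>M. \<exists>D V K K'. m \<in> D \<and> openin F D \<and> openin F V \<and> inj_on K D \<and> K ` D = V \<and>
           C1F F D F K \<and> (\<forall>x\<in>D. K' (K x) = x) \<and> C1F F V F K' \<and>
           K ` (M \<inter> D) = V \<inter> G))"

definition tangent_set :: "'a::real_vector topology \<Rightarrow> 'a set \<Rightarrow> 'a \<Rightarrow> 'a set" where
  "tangent_set F M m = {c' 0 | (c :: real \<Rightarrow> 'a) c'. c 0 = m \<and> (\<exists>e>0.
     c ` {-e<..<e} \<subseteq> M \<and>
     (\<forall>t\<in>{-e<..<e}. limitin F (\<lambda>h. (1 / h) *\<^sub>R (c (t + h) - c t)) (c' t) (at 0)) \<and>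
     continuous_map (top_of_set {-e<..<e}) F c')}"

section \<open>Function spaces\<close>

definition Cont :: "real set \<Rightarrow> (real \<Rightarrow> 'b::real_normed_vector) set" where
  "Cont J = {\<phi>. continuous_on J \<phi> \<and> (\<forall>t. t \<notin> J \<longrightarrow> \<phi> t = 0)}"

text \<open>At an end point of \<open>J\<close> the derivative is one-sided.\<close>

definition deriv_on :: "real set \<Rightarrow> (real \<Rightarrow> 'b::real_normed_vector) \<Rightarrow> real \<Rightarrow> 'b" where
  "deriv_on J \<phi> t = (if t \<in> J then vector_derivative \<phi> (at t within J) else 0)"

definition Cont1 :: "real set \<Rightarrow> (real \<Rightarrow> 'b::real_normed_vector) set" where
  "Cont1 J = {\<phi> \<in> Cont J. (\<forall>t\<in>J. \<phi> differentiable (at t within J)) \<and> continuous_on J (deriv_on J \<phi>)}"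

definition supnorm :: "real set \<Rightarrow> (real \<Rightarrow> 'b::real_normed_vector) \<Rightarrow> real" where
  "supnorm J \<phi> = (SUP t\<in>J. norm (\<phi> t))"

definition C_top :: "(real \<Rightarrow> 'b::real_normed_vector) topology" where
  "C_top = seminorm_topology (Cont {..0}) {supnorm {-r..0} | r. r > 0}"

definition C1_top :: "(real \<Rightarrow> 'b::real_normed_vector) topology" where
  "C1_top = seminorm_topology (Cont1 {..0})
     {\<lambda>\<phi>. supnorm {-r..0} \<phi> + supnorm {-r..0} (deriv_on {..0} \<phi>) | r. r > 0}"

definition Cd_top :: "real \<Rightarrow> (real \<Rightarrow> 'b::real_normed_vector) topology" where
  "Cd_top d = seminorm_topology (Cont {-d..0}) {supnorm {-d..0}}"

definition C1d_top :: "real \<Rightarrow> (real \<Rightarrow> 'b::real_normed_vector) topology" where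
  "C1d_top d = seminorm_topology (Cont1 {-d..0})
     {\<lambda>\<phi>. supnorm {-d..0} \<phi> + supnorm {-d..0} (deriv_on {-d..0} \<phi>)}"

definition norm_a :: "real \<Rightarrow> (real \<Rightarrow> 'b::real_normed_vector) \<Rightarrow> real" where
  "norm_a a \<phi> = (SUP t\<in>{..0}. norm (\<phi> t) * exp (a * t))"

definition Ba :: "real \<Rightarrow> (real \<Rightarrow> 'b::real_normed_vector) set" where
  "Ba a = {\<phi> \<in> Cont {..0}. bdd_above ((\<lambda>t. norm (\<phi> t) * exp (a * t)) ` {..0})}"

definition B1a :: "real \<Rightarrow> (real \<Rightarrow> 'b::real_normed_vector) set" where
  "B1a a = {\<phi> \<in> Cont1 {..0}. \<phi> \<in> Ba a \<and> deriv_on {..0} \<phi> \<in> Ba a}"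

definition norm_a1 :: "real \<Rightarrow> (real \<Rightarrow> 'b::real_normed_vector) \<Rightarrow> real" where
  "norm_a1 a \<phi> = norm_a a \<phi> + norm_a a (deriv_on {..0} \<phi>)"

definition B1a_top :: "real \<Rightarrow> (real \<Rightarrow> 'b::real_normed_vector) topology" where
  "B1a_top a = seminorm_topology (B1a a) {norm_a1 a}"

definition Rd1 :: "real \<Rightarrow> (real \<Rightarrow> 'b::real_normed_vector) \<Rightarrow> real \<Rightarrow> 'b" where
  "Rd1 d \<phi> = (\<lambda>s. if s \<in> {-d..0} then \<phi> s else 0)"

definition Pd1 :: "real \<Rightarrow> (real \<Rightarrow> 'b::real_normed_vector) \<Rightarrow> real \<Rightarrow> 'b" where
  "Pd1 d \<phi> = (\<lambda>s. if s \<in> {-d..0} then \<phi> s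
     else if s < -d then \<phi> (-d) + (s + d) *\<^sub>R deriv_on {-d..0} \<phi> (-d) else 0)"

definition j1 :: "(real \<Rightarrow> 'b::real_normed_vector) \<Rightarrow> real \<Rightarrow> 'b" where
  "j1 \<phi> = \<phi>"

section \<open>Solutions and semiflow\<close>

definition seg :: "real \<Rightarrow> (real \<Rightarrow> 'b::real_normed_vector) \<Rightarrow> real \<Rightarrow> 'b" where
  "seg t x = (\<lambda>s. if s \<le> 0 then x (t + s) else 0)"

definition seg_d :: "real \<Rightarrow> real \<Rightarrow> (real \<Rightarrow> 'b::real_normed_vector) \<Rightarrow> real \<Rightarrow> 'b" where
  "seg_d d t x = (\<lambda>s. if s \<in> {-d..0} then x (t + s) else 0)"

text \<open>The values of \<open>x\<close> outside the set of all \<open>s + t\<close> with \<open>s \<le> 0\<close>, \<open>t \<in> I\<close> are irrelevant.\<close>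

definition solution ::
  "(real \<Rightarrow> 'b::real_normed_vector) set \<Rightarrow> ((real \<Rightarrow> 'b) \<Rightarrow> 'b) \<Rightarrow> real set \<Rightarrow> (real \<Rightarrow> 'b) \<Rightarrow> bool" where
  "solution D g I x \<longleftrightarrow>
     (\<forall>t\<in>I. seg t x \<in> D \<and> (x has_vector_derivative g (seg t x)) (at t within I))"

definition solution_manifold ::
  "(real \<Rightarrow> 'b::real_normed_vector) set \<Rightarrow> ((real \<Rightarrow> 'b) \<Rightarrow> 'b) \<Rightarrow> (real \<Rightarrow> 'b) set" where
  "solution_manifold D g = {\<phi> \<in> D. deriv_on {..0} \<phi> 0 = g \<phi>}"

definition max_time ::
  "(real \<Rightarrow> 'b::real_normed_vector) set \<Rightarrow> ((real \<Rightarrow> 'b) \<Rightarrow> 'b) \<Rightarrow> (real \<Rightarrow> 'b) \<Rightarrow> ereal" where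
  "max_time D g \<phi> = Sup {ereal T | T. T > 0 \<and> (\<exists>x. solution D g {0..<T} x \<and> seg 0 x = \<phi>)}"

definition max_solution ::
  "(real \<Rightarrow> 'b::real_normed_vector) set \<Rightarrow> ((real \<Rightarrow> 'b) \<Rightarrow> 'b) \<Rightarrow> (real \<Rightarrow> 'b) \<Rightarrow> real \<Rightarrow> 'b" where
  "max_solution D g \<phi> =
     (SOME x. solution D g {t. 0 \<le> t \<and> ereal t < max_time D g \<phi>} x \<and> seg 0 x = \<phi>)"

definition semiflow ::
  "(real \<Rightarrow> 'b::real_normed_vector) set \<Rightarrow> ((real \<Rightarrow> 'b) \<Rightarrow> 'b) \<Rightarrow> real \<Rightarrow> (real \<Rightarrow> 'b) \<Rightarrow> real \<Rightarrow> 'b" where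
  "semiflow D g t \<phi> = seg t (max_solution D g \<phi>)"

definition stationary_point ::
  "(real \<Rightarrow> 'b::real_normed_vector) set \<Rightarrow> ((real \<Rightarrow> 'b) \<Rightarrow> 'b) \<Rightarrow> (real \<Rightarrow> 'b) \<Rightarrow> bool" where
  "stationary_point D g \<phi> \<longleftrightarrow> \<phi> \<in> solution_manifold D g \<and>
     (\<forall>t\<ge>0. ereal t < max_time D g \<phi> \<and> semiflow D g t \<phi> = \<phi>)"

definition property_e ::
  "(real \<Rightarrow> 'b::real_normed_vector) set \<Rightarrow> ((real \<Rightarrow> 'b) \<Rightarrow> 'b) \<Rightarrow> bool" where
  "property_e U f \<longleftrightarrow> (\<exists>De :: (real \<Rightarrow> 'b) \<Rightarrow> (real \<Rightarrow> 'b) \<Rightarrow> 'b.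
     (\<forall>\<phi>\<in>U. linear_on (topspace C_top) (De \<phi>) \<and>
        (\<forall>\<xi>\<in>topspace C1_top. De \<phi> \<xi> = dirderiv euclidean f \<phi> \<xi>)) \<and>
     continuous_map (prod_topology (subtopology C1_top U) C_top) euclidean (\<lambda>(\<phi>, \<xi>). De \<phi> \<xi>))"

section \<open>The unstable space of a linear autonomous delay equation\<close>

text \<open>
  The semigroup on \<open>C\<^sub>d\<close> given by \<open>v' t = L (v\<^sub>t)\<close>, and its infinitesimal generator as a graph.
\<close>

definition dde_semigroup ::
  "real \<Rightarrow> ((real \<Rightarrow> 'b) \<Rightarrow> 'b) \<Rightarrow> real \<Rightarrow> (real \<Rightarrow> 'b::real_normed_vector) \<Rightarrow> real \<Rightarrow> 'b" where
  "dde_semigroup d L t \<xi> = (THE \<eta>. \<exists>v. continuous_on {-d..} v \<and> seg_d d 0 v = \<xi> \<and>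
     (\<forall>s\<ge>0. (v has_vector_derivative L (seg_d d s v)) (at s within {0..})) \<and> \<eta> = seg_d d t v)"

definition dde_generator ::
  "real \<Rightarrow> ((real \<Rightarrow> 'b) \<Rightarrow> 'b) \<Rightarrow> ((real \<Rightarrow> 'b::real_normed_vector) \<times> (real \<Rightarrow> 'b)) set" where
  "dde_generator d L = {(\<xi>, \<eta>). \<xi> \<in> Cont {-d..0} \<and>
     limitin (Cd_top d) (\<lambda>t. (1 / t) *\<^sub>R (dde_semigroup d L t \<xi> - \<xi>)) \<eta> (at_right (0::real))}"

text \<open>
  Spectrum and spectral projections refer to the complexification of \<open>C\<^sub>d\<close>, which is the space
  \<open>Cont {-d..0}\<close> of maps with values in \<open>complex ^ 'n\<close>, and of the generator.
\<close>

definition Re_fun :: "(real \<Rightarrow> complex ^ 'n) \<Rightarrow> real \<Rightarrow> real ^ 'n" where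
  "Re_fun \<xi> = (\<lambda>s. \<chi> i. Re (\<xi> s $ i))"

definition Im_fun :: "(real \<Rightarrow> complex ^ 'n) \<Rightarrow> real \<Rightarrow> real ^ 'n" where
  "Im_fun \<xi> = (\<lambda>s. \<chi> i. Im (\<xi> s $ i))"

definition complexify :: "(real \<Rightarrow> real ^ 'n) \<Rightarrow> real \<Rightarrow> complex ^ 'n" where
  "complexify \<xi> = (\<lambda>s. \<chi> i. complex_of_real (\<xi> s $ i))"

definition complex_graph ::
  "((real \<Rightarrow> real ^ 'n) \<times> (real \<Rightarrow> real ^ 'n)) set \<Rightarrow> ((real \<Rightarrow> complex ^ 'n) \<times> (real \<Rightarrow> complex ^ 'n)) set" where
  "complex_graph A = {(\<xi>, \<eta>). (Re_fun \<xi>, Re_fun \<eta>) \<in> A \<and> (Im_fun \<xi>, Im_fun \<eta>) \<in> A}"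

text \<open>\<open>(\<xi>, z \<xi> - \<eta>)\<close> belongs to the graph of \<open>A\<close> iff \<open>(z - A) \<xi> = \<eta>\<close>.\<close>

definition resolvent_set ::
  "real \<Rightarrow> ((real \<Rightarrow> complex ^ 'n) \<times> (real \<Rightarrow> complex ^ 'n)) set \<Rightarrow> complex set" where
  "resolvent_set d A = {z.
     (\<forall>\<eta>\<in>Cont {-d..0}. \<exists>!\<xi>. (\<xi>, (\<lambda>s. z *s \<xi> s - \<eta> s)) \<in> A) \<and>
     (\<exists>k. \<forall>(\<xi>, \<zeta>)\<in>A. supnorm {-d..0} \<xi> \<le> k * supnorm {-d..0} (\<lambda>s. z *s \<xi> s - \<zeta> s))}"

definition resolvent ::
  "((real \<Rightarrow> complex ^ 'n) \<times> (real \<Rightarrow> complex ^ 'n)) set \<Rightarrow> complex \<Rightarrow>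
    (real \<Rightarrow> complex ^ 'n) \<Rightarrow> real \<Rightarrow> complex ^ 'n" where
  "resolvent A z \<eta> = (THE \<xi>. (\<xi>, (\<lambda>s. z *s \<xi> s - \<eta> s)) \<in> A)"

text \<open>Riesz projection; the contour integral of the resolvent is evaluated pointwise.\<close>

definition riesz ::
  "((real \<Rightarrow> complex ^ 'n) \<times> (real \<Rightarrow> complex ^ 'n)) set \<Rightarrow> (real \<Rightarrow> complex) \<Rightarrow>
    (real \<Rightarrow> complex ^ 'n) \<Rightarrow> real \<Rightarrow> complex ^ 'n" where
  "riesz A \<gamma> \<eta> = (\<lambda>s. \<chi> i.
     contour_integral \<gamma> (\<lambda>z. resolvent A z \<eta> s $ i) / (2 * complex_of_real pi * \<i>))"

text \<open>
  The real part of the range of the Riesz projection for the part of the spectrum in the open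
  right half-plane.  The projection does not depend on the choice of the contour.
\<close>

definition unstable_space ::
  "real \<Rightarrow> ((real \<Rightarrow> real ^ 'n) \<Rightarrow> real ^ 'n) \<Rightarrow> (real \<Rightarrow> real ^ 'n) set" where
  "unstable_space d L = {\<xi> \<in> Cont {-d..0}. \<exists>\<gamma>.
     valid_path \<gamma> \<and> pathfinish \<gamma> = pathstart \<gamma> \<and>
     path_image \<gamma> \<subseteq> resolvent_set d (complex_graph (dde_generator d L)) \<and>
     (\<forall>z. z \<notin> resolvent_set d (complex_graph (dde_generator d L)) \<longrightarrow>
        winding_number \<gamma> z = (if Re z > 0 then 1 else 0)) \<and>
     (\<exists>\<eta>\<in>Cont {-d..0}. complexify \<xi> = riesz (complex_graph (dde_generator d L)) \<gamma> \<eta>)}"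

text \<open>The space \<open>Y\<^sub>u\<close>.\<close>

definition unstable_histories ::
  "real \<Rightarrow> ((real \<Rightarrow> real ^ 'n) \<Rightarrow> real ^ 'n) \<Rightarrow> (real \<Rightarrow> real ^ 'n) set" where
  "unstable_histories d L = {seg 0 v | v \<xi>. \<xi> \<in> unstable_space d L \<and> seg_d d 0 v = \<xi> \<and>
     (\<forall>t. (v has_vector_derivative L (seg_d d t v)) (at t)) \<and>
     (\<forall>t. seg_d d t v \<in> unstable_space d L)}"

end

theory Submission
  imports Defs
begin

text \<open>
  The segments of a history that approaches the stationary point exponentially together with its
  derivative converge in \<open>B1a a\<close>, at the same rate.  Hence they eventually lie in \<open>Ua\<close>, where
  the equations given by \<open>f\<close> and by \<open>fa\<close> coincide, and the known characterization (II) of \<open>Wua\<close>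
  applies; since \<open>Wu\<close> is a neighbourhood of the stationary point in \<open>Wua\<close> with respect to the
  norm of \<open>B1a a\<close>, they eventually lie in \<open>Wu\<close>.  Conversely, evaluation at \<open>0\<close> is
  dominated by that norm, which turns (I) into the pointwise estimates.
\<close>

section \<open>Neighbourhoods in topologies given by seminorms\<close>

text \<open>A basic neighbourhood involves only finitely many seminorms, each controlled by
  \<open>q\<close>, so a minimum of radii \<open>e / K\<close> works. The map \<open>h\<close> lets
  one argument serve both inclusions and the restriction \<open>Rd1 d\<close>.\<close>

lemma seminorm_topology_nbhd:
  assumes "openin (seminorm_topology S P) G" "x \<in> G"
    and dom: "\<And>p. p \<in> P \<Longrightarrow> \<exists>K>0. \<forall>y\<in>T. p (h y - x) \<le> K * q y"
    and S: "\<And>y. y \<in> T \<Longrightarrow> h y \<in> S"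
  shows "\<exists>\<delta>>0. \<forall>y\<in>T. q y < \<delta> \<longrightarrow> h y \<in> G"
proof -
  obtain F e where F: "finite F" "F \<subseteq> P" "e > 0" "{y\<in>S. \<forall>p\<in>F. p (y - x) < e} \<subseteq> G"
    using assms(1,2) unfolding openin_seminorm_topology by blast
  from F(1,2) have "\<exists>\<delta>>0. \<forall>y\<in>T. q y < \<delta> \<longrightarrow> (\<forall>p\<in>F. p (h y - x) < e)"
  proof (induction F)
    case empty
    then show ?case by (auto intro: exI[of _ 1])
  next
    case (insert p F)
    then obtain \<delta> where \<delta>: "\<delta> > 0" "\<forall>y\<in>T. q y < \<delta> \<longrightarrow> (\<forall>p\<in>F. p (h y - x) < e)"
      by auto
    obtain K where K: "K > 0" "\<forall>y\<in>T. p (h y - x) \<le> K * q y"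
      using dom[of p] insert.prems by auto
    have "p (h y - x) < e" if "y \<in> T" "q y < e / K" for y
    proof -
      have "K * q y < e" using that K(1) by (simp add: field_simps)
      then show ?thesis using K(2) that by fastforce
    qed
    then show ?case using \<delta> K(1) F(3)
      by (intro exI[of _ "min \<delta> (e / K)"]) auto
  qed
  then obtain \<delta> where \<delta>: "\<delta> > 0" "\<And>y p. \<lbrakk>y \<in> T; q y < \<delta>; p \<in> F\<rbrakk> \<Longrightarrow> p (h y - x) < e"
    by blast
  have "h y \<in> G" if "y \<in> T" "q y < \<delta>" for y
    using \<delta>(2)[OF that] S[OF that(1)] by (intro subsetD[OF F(4)]) simp
  then show ?thesis using \<delta>(1) by blast
qed

section \<open>One-sided derivatives and the spaces \<open>Cont1 J\<close>\<close>

text \<open>At an isolated point of \<open>J\<close> every vector would be a derivative; the limit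
  point condition excludes this.\<close>

lemma deriv_on_unique:
  assumes "(\<phi> has_vector_derivative D) (at t within J)" "t \<in> J" "t islimpt J"
  shows "deriv_on J \<phi> t = D"
  using assms by (simp add: deriv_on_def vector_derivative_within trivial_limit_within)

lemma Cont1_has_vector_derivative:
  assumes "\<phi> \<in> Cont1 J" "t \<in> J"
  shows "(\<phi> has_vector_derivative deriv_on J \<phi> t) (at t within J)"
  using assms by (simp add: Cont1_def deriv_on_def vector_derivative_works)

lemma deriv_on_outside: "t \<notin> J \<Longrightarrow> deriv_on J \<phi> t = 0"
  by (simp add: deriv_on_def)

text \<open>Membership and derivative are obtained together. \<open>D\<close> has to vanish off
  \<open>J\<close>, since \<open>deriv_on J\<close> is \<open>0\<close> there by convention and the
  equality is one of functions on the whole line.\<close>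

lemma Cont1I:
  assumes J: "\<And>t. t \<in> J \<Longrightarrow> t islimpt J"
    and der: "\<And>t. t \<in> J \<Longrightarrow> (\<phi> has_vector_derivative D t) (at t within J)"
    and D: "continuous_on J D"
    and zero: "\<And>t. t \<notin> J \<Longrightarrow> \<phi> t = 0" "\<And>t. t \<notin> J \<Longrightarrow> D t = 0"
  shows "\<phi> \<in> Cont1 J" "deriv_on J \<phi> = D"
proof -
  show eq: "deriv_on J \<phi> = D"
  proof
    fix t show "deriv_on J \<phi> t = D t"
      using deriv_on_unique[OF der _ J, of t] zero(2)[of t] by (cases "t \<in> J") (auto simp: deriv_on_outside)
  qed
  have "continuous_on J \<phi>"
    by (rule continuous_on_vector_derivative) (rule der)
  moreover have "\<forall>t\<in>J. \<phi> differentiable (at t within J)"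
    using der by (blast intro: differentiableI_vector)
  ultimately show "\<phi> \<in> Cont1 J"
    using zero(1) D eq by (simp add: Cont1_def Cont_def)
qed

lemma islimpt_atMost_real: "t \<le> (0::real) \<Longrightarrow> t islimpt {..0}"
  by (rule islimpt_subset[of t "{t-1..t}"]) (auto simp: islimpt_Icc)

lemma Cont1_diff:
  assumes J: "\<And>t. t \<in> J \<Longrightarrow> t islimpt J" and "\<phi> \<in> Cont1 J" "\<psi> \<in> Cont1 J"
  shows "\<phi> - \<psi> \<in> Cont1 J" "deriv_on J (\<phi> - \<psi>) = deriv_on J \<phi> - deriv_on J \<psi>"
proof -
  have der: "(\<phi> - \<psi> has_vector_derivative (deriv_on J \<phi> - deriv_on J \<psi>) t) (at t within J)"
    if "t \<in> J" for t
    using has_vector_derivative_diff[OF assms(2,3)[THEN Cont1_has_vector_derivative[OF _ that]]]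
    by (simp add: fun_diff_def)
  have cont: "continuous_on J (deriv_on J \<phi> - deriv_on J \<psi>)"
    using assms(2,3) unfolding fun_diff_def Cont1_def by (auto intro: continuous_on_diff)
  have zero: "(\<phi> - \<psi>) t = 0" "(deriv_on J \<phi> - deriv_on J \<psi>) t = 0" if "t \<notin> J" for t
    using assms(2,3) that by (auto simp: Cont1_def Cont_def deriv_on_outside)
  show "\<phi> - \<psi> \<in> Cont1 J" "deriv_on J (\<phi> - \<psi>) = deriv_on J \<phi> - deriv_on J \<psi>"
    by (rule Cont1I[where D = "deriv_on J \<phi> - deriv_on J \<psi>"]; fact J der cont zero)+
qed

text \<open>Chain rule for the translation by \<open>s\<close>. It maps \<open>{..0}\<close> onto
  \<open>{..s}\<close>, which stays inside \<open>{..0}\<close> because \<open>s \<le> 0\<close>, so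
  the derivative of \<open>x\<close> within \<open>{..0}\<close> can be restricted to it.\<close>

lemma has_vector_derivative_seg:
  assumes "(x has_vector_derivative D) (at (s + t) within {..0})" "s \<le> 0" "t \<le> 0"
  shows "(seg s x has_vector_derivative D) (at t within {..0})"
proof -
  have "((+) s has_vector_derivative 1) (at t within {..0})"
    by (auto intro!: derivative_eq_intros)
  moreover have "(x has_vector_derivative D) (at (s + t) within (+) s ` {..0})"
    using assms(2) by (intro has_vector_derivative_within_subset[OF assms(1)]) auto
  ultimately have "(x \<circ> (+) s has_vector_derivative D) (at t within {..0})"
    using vector_diff_chain_within by fastforce
  then show ?thesis
    using assms(3) by (intro has_vector_derivative_transform[of t "{..0}" "seg s x"]) (auto simp: seg_def)
qed

lemma Cont1_seg:
  assumes "\<phi> \<in> Cont1 {..0}" "s \<le> 0"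
  shows "seg s \<phi> \<in> Cont1 {..0}" "deriv_on {..0} (seg s \<phi>) = seg s (deriv_on {..0} \<phi>)"
proof -
  have der: "(seg s \<phi> has_vector_derivative seg s (deriv_on {..0} \<phi>) t) (at t within {..0})"
    if "t \<in> {..0}" for t
  proof -
    have "(seg s \<phi> has_vector_derivative deriv_on {..0} \<phi> (s + t)) (at t within {..0})"
      using that assms(2)
      by (intro has_vector_derivative_seg Cont1_has_vector_derivative[OF assms(1)]) auto
    then show ?thesis using that by (simp only: seg_def[of s "deriv_on _ _"] atMost_iff if_True)
  qed
  have "continuous_on {..0} (deriv_on {..0} \<phi>)"
    using assms(1) by (simp add: Cont1_def)
  then have "continuous_on {..0} (\<lambda>t. deriv_on {..0} \<phi> (s + t))"
    by (rule continuous_on_compose2) (use assms(2) in \<open>auto intro: continuous_intros\<close>)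
  then have cont: "continuous_on {..0} (seg s (deriv_on {..0} \<phi>))"
    by (rule continuous_on_eq) (simp add: seg_def)
  have zero: "seg s \<phi> t = 0" "seg s (deriv_on {..0} \<phi>) t = 0" if "t \<notin> {..0}" for t
    using that by (simp_all add: seg_def)
  show "seg s \<phi> \<in> Cont1 {..0}" "deriv_on {..0} (seg s \<phi>) = seg s (deriv_on {..0} \<phi>)"
    using Cont1I[OF _ der cont zero] by (simp_all add: islimpt_atMost_real)
qed

text \<open>Derivatives within \<open>{..0}\<close> restrict to the smaller interval, at
  \<open>-d\<close> to a one-sided one. With \<open>d > 0\<close> the interval is nondegenerate, so
  all its points are limit points.\<close>

lemma Cont1_Rd1:
  assumes "\<phi> \<in> Cont1 {..0}" "d > 0"
  shows "Rd1 d \<phi> \<in> Cont1 {-d..0}" "deriv_on {-d..0} (Rd1 d \<phi>) = Rd1 d (deriv_on {..0} \<phi>)"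
proof -
  have der: "(Rd1 d \<phi> has_vector_derivative Rd1 d (deriv_on {..0} \<phi>) t) (at t within {-d..0})"
    if "t \<in> {-d..0}" for t
  proof -
    have "(\<phi> has_vector_derivative deriv_on {..0} \<phi> t) (at t within {-d..0})"
      using that
      by (intro has_vector_derivative_within_subset[OF Cont1_has_vector_derivative[OF assms(1)]]) auto
    then have "(\<phi> has_vector_derivative Rd1 d (deriv_on {..0} \<phi>) t) (at t within {-d..0})"
      using that by (simp only: Rd1_def if_True)
    then show ?thesis
      using that by (intro has_vector_derivative_transform[of t _ "Rd1 d \<phi>"]) (auto simp: Rd1_def)
  qed
  have "continuous_on {-d..0} (deriv_on {..0} \<phi>)"
    using assms(1) unfolding Cont1_def by (auto elim: continuous_on_subset)
  then have cont: "continuous_on {-d..0} (Rd1 d (deriv_on {..0} \<phi>))"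
    by (rule continuous_on_eq) (simp add: Rd1_def)
  have zero: "Rd1 d \<phi> t = 0" "Rd1 d (deriv_on {..0} \<phi>) t = 0" if "t \<notin> {-d..0}" for t
    using that by (simp_all only: Rd1_def if_False)
  show "Rd1 d \<phi> \<in> Cont1 {-d..0}"
      "deriv_on {-d..0} (Rd1 d \<phi>) = Rd1 d (deriv_on {..0} \<phi>)"
    using Cont1I[OF _ der cont zero] assms(2) by (simp_all add: islimpt_Icc)
qed

section \<open>The weighted spaces \<open>Ba a\<close> and \<open>B1a a\<close>\<close>

lemma norm_a_upper:
  assumes "\<phi> \<in> Ba a" "t \<le> 0"
  shows "norm (\<phi> t) * exp (a * t) \<le> norm_a a \<phi>"
  using assms unfolding norm_a_def Ba_def by (intro cSUP_upper) auto

lemma norm_a_nonneg: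
  assumes "\<phi> \<in> Ba a" shows "0 \<le> norm_a a \<phi>"
  using norm_a_upper[OF assms, of 0] norm_ge_zero[of "\<phi> 0"] by (simp del: norm_ge_zero)

text \<open>On \<open>{-r..0}\<close> the weight \<open>exp (a * t)\<close> is at least
  \<open>exp (- a * r)\<close>, so locally the weighted norm dominates the sup norm.\<close>

lemma supnorm_le_norm_a:
  assumes "\<phi> \<in> Ba a" "a \<ge> 0" "r > 0"
  shows "supnorm {-r..0} \<phi> \<le> exp (a * r) * norm_a a \<phi>"
  unfolding supnorm_def
proof (rule cSUP_least)
  fix t assume t: "t \<in> {-r..0}"
  have "norm (\<phi> t) = exp (- (a * t)) * (norm (\<phi> t) * exp (a * t))"
    by (simp add: exp_minus field_simps)
  also have "\<dots> \<le> exp (- (a * t)) * norm_a a \<phi>"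
    using norm_a_upper[OF assms(1)] t by (intro mult_left_mono) auto
  also have "\<dots> \<le> exp (a * r) * norm_a a \<phi>"
    using t mult_left_mono[of "-t" r a] assms(2) norm_a_nonneg[OF assms(1)]
    by (intro mult_right_mono) auto
  finally show "norm (\<phi> t) \<le> exp (a * r) * norm_a a \<phi>" .
qed (use assms(3) in auto)

lemma Ba_diff:
  assumes "\<phi> \<in> Ba a" "\<psi> \<in> Ba a"
  shows "\<phi> - \<psi> \<in> Ba a"
proof -
  have "norm ((\<phi> - \<psi>) t) * exp (a * t) \<le> norm_a a \<phi> + norm_a a \<psi>" if "t \<le> 0" for t
  proof -
    have "norm ((\<phi> - \<psi>) t) * exp (a * t) \<le> (norm (\<phi> t) + norm (\<psi> t)) * exp (a * t)"
      by (intro mult_right_mono) (auto simp: norm_triangle_ineq4)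
    then show ?thesis
      using norm_a_upper[OF assms(1) that] norm_a_upper[OF assms(2) that]
      by (simp add: algebra_simps)
  qed
  then have "bdd_above ((\<lambda>t. norm ((\<phi> - \<psi>) t) * exp (a * t)) ` {..0})"
    by (intro bdd_aboveI2) auto
  moreover have "continuous_on {..0} (\<phi> - \<psi>)"
    using assms unfolding fun_diff_def Ba_def Cont_def by (auto intro: continuous_on_diff)
  ultimately show ?thesis
    using assms by (auto simp: Ba_def Cont_def)
qed

lemma B1a_diff:
  assumes "\<phi> \<in> B1a a" "\<psi> \<in> B1a a"
  shows "\<phi> - \<psi> \<in> B1a a"
  using assms Cont1_diff[of "{..0}" \<phi> \<psi>] islimpt_atMost_real by (auto simp: B1a_def Ba_diff)

text \<open>For \<open>a \<ge> 0\<close> the weight is at most \<open>1\<close> on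
  \<open>{..0}\<close>, so a uniform bound also bounds the weighted norm.\<close>

lemma norm_a_bounded:
  assumes "\<phi> \<in> Cont {..0}" "a \<ge> 0" "\<And>t. t \<le> 0 \<Longrightarrow> norm (\<phi> t) \<le> A"
  shows "\<phi> \<in> Ba a" "norm_a a \<phi> \<le> A"
proof -
  have *: "norm (\<phi> t) * exp (a * t) \<le> A" if "t \<in> {..0}" for t
  proof -
    have "norm (\<phi> t) * exp (a * t) \<le> norm (\<phi> t) * 1"
      using that assms(2) by (intro mult_left_mono) (auto simp: mult_nonneg_nonpos)
    then show ?thesis using assms(3)[of t] that by simp
  qed
  show "\<phi> \<in> Ba a" using assms(1) * by (auto simp: Ba_def intro!: bdd_aboveI2)
  show "norm_a a \<phi> \<le> A" unfolding norm_a_def using * by (intro cSUP_least) auto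
qed

lemma B1a_bounded:
  assumes "\<phi> \<in> Cont1 {..0}" "a \<ge> 0" "\<And>t. t \<le> 0 \<Longrightarrow> norm (\<phi> t) \<le> A"
    "\<And>t. t \<le> 0 \<Longrightarrow> norm (deriv_on {..0} \<phi> t) \<le> B"
  shows "\<phi> \<in> B1a a" "norm_a1 a \<phi> \<le> A + B"
proof -
  have "\<phi> \<in> Cont {..0}" "deriv_on {..0} \<phi> \<in> Cont {..0}"
    using assms(1) by (auto simp: Cont1_def Cont_def deriv_on_outside)
  then show "\<phi> \<in> B1a a" "norm_a1 a \<phi> \<le> A + B"
    using norm_a_bounded[OF _ assms(2)] assms
    by (auto simp: B1a_def norm_a1_def intro!: add_mono)
qed

section \<open>Neighbourhoods of a point of \<open>B1a a\<close> in the three topologies\<close>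

text \<open>Continuity of the inclusion \<open>j1\<close> at \<open>x\<close>: each defining
  seminorm of \<open>C1_top\<close> is at most \<open>exp (a * r)\<close> times
  \<open>norm_a1 a\<close>.\<close>

lemma C1_top_B1a_nbhd:
  assumes "openin C1_top G" "x \<in> G" "x \<in> B1a a" "a \<ge> 0"
  shows "\<exists>\<delta>>0. \<forall>y\<in>B1a a. norm_a1 a (y - x) < \<delta> \<longrightarrow> y \<in> G"
proof (rule seminorm_topology_nbhd[OF assms(1)[unfolded C1_top_def] assms(2), where h = "\<lambda>y. y"])
  fix p :: "(real \<Rightarrow> 'a) \<Rightarrow> real"
  assume "p \<in> {\<lambda>\<phi>. supnorm {-r..0} \<phi> + supnorm {-r..0} (deriv_on {..0} \<phi>) | r. r > 0}"
  then obtain r where r: "r > 0" "p = (\<lambda>\<phi>. supnorm {-r..0} \<phi> + supnorm {-r..0} (deriv_on {..0} \<phi>))"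
    by auto
  have "p (y - x) \<le> exp (a * r) * norm_a1 a (y - x)" if "y \<in> B1a a" for y
  proof -
    have "y - x \<in> B1a a" by (rule B1a_diff[OF that assms(3)])
    then show ?thesis
      using supnorm_le_norm_a[OF _ assms(4) r(1)] unfolding B1a_def r(2) norm_a1_def distrib_left
      by (intro add_mono) auto
  qed
  then show "\<exists>K>0. \<forall>y\<in>B1a a. p (y - x) \<le> K * norm_a1 a (y - x)"
    by (intro exI[of _ "exp (a * r)"]) auto
qed (auto simp: B1a_def)

text \<open>Continuity at \<open>x\<close> of the restriction from \<open>B1a a\<close> to
  \<open>[-d, 0]\<close>, by the same estimate with \<open>r = d\<close>, as \<open>Rd1 d\<close> is
  linear and commutes with differentiation.\<close>

lemma C1d_top_B1a_nbhd:
  assumes "openin (C1d_top d) G" "Rd1 d x \<in> G" "x \<in> B1a a" "a \<ge> 0" "d > 0"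
  shows "\<exists>\<delta>>0. \<forall>y\<in>B1a a. norm_a1 a (y - x) < \<delta> \<longrightarrow> Rd1 d y \<in> G"
proof (rule seminorm_topology_nbhd[OF assms(1)[unfolded C1d_top_def] assms(2)])
  fix p :: "(real \<Rightarrow> 'a) \<Rightarrow> real"
  assume "p \<in> {\<lambda>\<phi>. supnorm {-d..0} \<phi> + supnorm {-d..0} (deriv_on {-d..0} \<phi>)}"
  then have p: "p = (\<lambda>\<phi>. supnorm {-d..0} \<phi> + supnorm {-d..0} (deriv_on {-d..0} \<phi>))"
    by auto
  have "p (Rd1 d y - Rd1 d x) \<le> exp (a * d) * norm_a1 a (y - x)" if "y \<in> B1a a" for y
  proof -
    have yx: "y - x \<in> B1a a" by (rule B1a_diff[OF that assms(3)])
    have R: "Rd1 d y - Rd1 d x = Rd1 d (y - x)" by (auto simp: Rd1_def fun_eq_iff)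
    have sup: "supnorm {-d..0} (Rd1 d z) = supnorm {-d..0} z" for z :: "real \<Rightarrow> 'a"
      unfolding supnorm_def by (rule SUP_cong) (auto simp: Rd1_def)
    have D: "deriv_on {-d..0} (Rd1 d (y - x)) = Rd1 d (deriv_on {..0} (y - x))"
      using Cont1_Rd1(2)[OF _ assms(5)] yx by (auto simp: B1a_def)
    show ?thesis
      using supnorm_le_norm_a[OF _ assms(4,5)] yx unfolding B1a_def p norm_a1_def distrib_left R D sup
      by (intro add_mono) auto
  qed
  then show "\<exists>K>0. \<forall>y\<in>B1a a. p (Rd1 d y - Rd1 d x) \<le> K * norm_a1 a (y - x)"
    by (intro exI[of _ "exp (a * d)"]) auto
qed (use assms(5) Cont1_Rd1(1) in \<open>auto simp: B1a_def\<close>)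

lemma B1a_top_nbhd:
  assumes "openin (B1a_top a) G" "x \<in> G"
  shows "\<exists>\<delta>>0. \<forall>y\<in>B1a a. norm_a1 a (y - x) < \<delta> \<longrightarrow> y \<in> G"
  using assms(1) unfolding B1a_top_def
  by (rule seminorm_topology_nbhd[OF _ assms(2), where h = "\<lambda>y. y"]) (auto intro!: exI[of _ 1])

section \<open>Stationary points, zero tangent vectors and exponential decay\<close>

text \<open>All segments at nonnegative times of one solution \<open>x\<close> equal
  \<open>\<phi>\<close>. The number \<open>x 0\<close> is read off twice: as the value at
  \<open>s\<close> of the segment at time \<open>-s\<close>, and as the value at \<open>0\<close> of
  the segment at time \<open>0\<close>.\<close>

lemma stationary_point_constant:
  assumes "stationary_point D g \<phi>" "s \<le> 0"
  shows "\<phi> s = \<phi> 0"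
proof -
  have "seg t (max_solution D g \<phi>) = \<phi>" if "t \<ge> 0" for t
    using assms(1) that unfolding stationary_point_def semiflow_def by blast
  from this[of "-s"] this[of 0] show ?thesis
    using assms(2) by (metis add.commute add.right_inverse add_0 le_cases neg_0_le_iff_le seg_def)
qed

lemma deriv_on_constant:
  assumes "\<And>s. s \<le> 0 \<Longrightarrow> \<phi> s = \<phi> 0"
  shows "deriv_on {..0} \<phi> = 0"
proof
  fix t :: real
  show "deriv_on {..0} \<phi> t = 0 t"
  proof (cases "t \<le> 0")
    case True
    have "(\<phi> has_vector_derivative 0) (at t within {..0})"
      by (rule has_vector_derivative_transform[OF _ _ has_vector_derivative_const[of "\<phi> 0"]])
         (use True in \<open>auto intro: assms\<close>)
    from deriv_on_unique[OF this] show ?thesis using True by (simp add: islimpt_atMost_real)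
  qed (simp add: deriv_on_outside)
qed

text \<open>The zero vector is the velocity of the constant curve at \<open>m\<close>.\<close>

lemma zero_in_tangent_set:
  assumes "m \<in> M" "0 \<in> topspace F"
  shows "0 \<in> tangent_set F M m"
  unfolding tangent_set_def
  using assms by (intro CollectI exI[of _ "\<lambda>_. m"] exI[of _ "\<lambda>_. 0"] conjI exI[of _ 1])
    (auto simp: limitin_const_iff)

lemma exp_at_bot_le:
  assumes "\<beta> > 0" "\<delta> > 0"
  shows "\<exists>s0\<le>0. \<forall>s\<le>s0. K * exp (\<beta> * s) < (\<delta>::real)"
proof -
  have "((\<lambda>s. K * exp (\<beta> * s)) \<longlongrightarrow> K * 0) at_bot"
    using assms(1)
    by (intro tendsto_intros filterlim_compose[OF exp_at_bot]
        filterlim_tendsto_pos_mult_at_bot[OF tendsto_const _ filterlim_ident])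
  then have "eventually (\<lambda>s. K * exp (\<beta> * s) < \<delta>) at_bot"
    using assms(2) by (intro order_tendstoD(2)[of _ "K * 0"]) auto
  then obtain s1 where "\<forall>s\<le>s1. K * exp (\<beta> * s) < \<delta>"
    by (auto simp: eventually_at_bot_linorder)
  then show ?thesis by (intro exI[of _ "min s1 0"]) auto
qed

text \<open>With \<open>t \<le> 0\<close> the outer segment only evaluates the inner one at
  nonpositive arguments, where its cut-off to \<open>0\<close> does not act.\<close>

lemma seg_seg: "t \<le> 0 \<Longrightarrow> seg t (seg s x) = seg (s + t) x"
  by (auto simp: seg_def fun_eq_iff add.assoc)

theorem proposition16p1:
  fixes U N Ud Ua Xa Yu Yeps Wua Wu :: "(real \<Rightarrow> real ^ 'n) set"
    and f fd fa L :: "(real \<Rightarrow> real ^ 'n) \<Rightarrow> real ^ 'n"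
    and w :: "(real \<Rightarrow> real ^ 'n) \<Rightarrow> (real \<Rightarrow> real ^ 'n)"
    and \<phi>0 :: "real \<Rightarrow> real ^ 'n"
    and a d \<beta> \<gamma> cu \<epsilon> :: real
  assumes U: "openin C1_top U"
    and f: "C1F C1_top U euclidean f"
    and e: "property_e U f"
    and stat: "stationary_point U f \<phi>0"
    and a: "a > 0"
    and N: "openin C1_top N" "N \<subseteq> U" "\<phi>0 \<in> N"
    and d: "d > 0"
    and Nd: "\<And>\<xi> \<psi>. \<lbrakk>\<xi> \<in> N; \<psi> \<in> N; \<And>s. s \<in> {-d..0} \<Longrightarrow> \<xi> s = \<psi> s\<rbrakk> \<Longrightarrow> f \<xi> = f \<psi>"
    and Ud: "openin (C1d_top d) Ud" "Rd1 d \<phi>0 \<in> Ud" "Pd1 d ` Ud \<subseteq> N"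
    and fd: "fd = (\<lambda>\<phi>. f (Pd1 d \<phi>))"
    and L: "L \<in> Lc (Cd_top d) euclidean"
      "\<And>\<xi>. \<xi> \<in> topspace (C1d_top d) \<Longrightarrow> L \<xi> = dirderiv euclidean fd (Rd1 d \<phi>0) \<xi>"
    and Yu: "Yu = unstable_histories d L"
    and Ua: "Ua = {\<phi> \<in> B1a a. j1 \<phi> \<in> N \<and> Rd1 d (j1 \<phi>) \<in> Ud}"
    and fa: "fa = (\<lambda>\<phi>. f (j1 \<phi>))"
    and Xa: "Xa = solution_manifold Ua fa"
    and Wua: "Wua \<subseteq> Xa" "\<phi>0 \<in> Wua" "C1F_submanifold (B1a_top a) Wua"
      "tangent_set (B1a_top a) Wua \<phi>0 = Yu"
      "\<And>\<phi>. \<phi> \<in> Wua \<Longrightarrow> solution Ua fa {..0} \<phi>"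
      "\<And>\<phi>. \<phi> \<in> Wua \<Longrightarrow> limitin (B1a_top a) (\<lambda>s. seg s \<phi>) \<phi>0 at_bot"
    and rates: "\<beta> > \<gamma>" "\<gamma> > 0" "cu > 0"
    and I: "\<And>\<phi> s. \<lbrakk>\<phi> \<in> Wua; s \<le> 0\<rbrakk> \<Longrightarrow>
      norm_a1 a (seg s \<phi> - \<phi>0) \<le> cu * exp (\<beta> * s) * norm_a1 a (\<phi> - \<phi>0)"
    and II: "\<And>\<psi>. \<lbrakk>\<psi> \<in> B1a a; solution Ua fa {..0} \<psi>;
        bdd_above ((\<lambda>s. norm_a1 a (seg s \<psi> - \<phi>0) * exp (- \<gamma> * s)) ` {..0})\<rbrakk> \<Longrightarrow>
      \<exists>s\<psi>\<le>0. \<forall>s\<le>s\<psi>. seg s \<psi> \<in> Wua"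
    and eps: "\<epsilon> > 0"
    and Yeps: "Yeps = {\<phi> \<in> Yu. norm_a1 a \<phi> < \<epsilon>}"
    and w: "C1F (subtopology (B1a_top a) Yu) Yeps (B1a_top a) w" "w 0 = \<phi>0"
      "openin (subtopology (B1a_top a) Wua) (w ` Yeps)"
      "\<And>\<eta>. \<eta> \<in> Yu \<Longrightarrow> dirderiv (B1a_top a) w 0 \<eta> = \<eta>"
    and Wu: "Wu = j1 ` w ` Yeps" "C1F_submanifold C1_top Wu" "tangent_set C1_top Wu \<phi>0 = Yu"
  shows "(\<forall>\<phi>\<in>Wu. solution U f {..0} \<phi> \<and> limitin C1_top (\<lambda>s. seg s \<phi>) \<phi>0 at_bot \<and>
           (\<forall>s\<le>0. norm (\<phi> s - \<phi>0 0) \<le> cu * exp (\<beta> * s) * norm_a1 a (\<phi> - \<phi>0) \<and>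
                   norm (deriv_on {..0} \<phi> s) \<le> cu * exp (\<beta> * s) * norm_a1 a (\<phi> - \<phi>0))) \<and>
         (\<forall>\<psi>\<in>solution_manifold U f. solution U f {..0} \<psi> \<and>
            bdd_above ((\<lambda>s. exp (- \<gamma> * s) * norm (\<psi> s - \<phi>0 0)) ` {..0}) \<and>
            bdd_above ((\<lambda>s. exp (- \<gamma> * s) * norm (deriv_on {..0} \<psi> s)) ` {..0}) \<longrightarrow>
            (\<exists>s\<psi>\<le>0. \<forall>s\<le>s\<psi>. seg s \<psi> \<in> Wu))"
proof -
  have const: "\<phi>0 s = \<phi>0 0" if "s \<le> 0" for s
    using stationary_point_constant[OF stat that] .
  have D0: "deriv_on {..0} \<phi>0 = 0"
    by (rule deriv_on_constant) (rule const)
  have B0: "\<phi>0 \<in> B1a a"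
    using Wua(1,2) unfolding Xa Ua solution_manifold_def by auto
  have C0: "\<phi>0 \<in> Cont1 {..0}" using B0 by (simp add: B1a_def)
  have UaU: "Ua \<subseteq> U" using N(2) by (auto simp: Ua j1_def)
  have Ua_B: "Ua \<subseteq> B1a a" by (auto simp: Ua)
  have Wu_sub: "Wu \<subseteq> Wua"
    using openin_subset[OF w(3)] by (auto simp: Wu(1) j1_def)
  have zero_B: "(0 :: real \<Rightarrow> real ^ 'n) \<in> B1a a"
    using B1a_diff[OF B0 B0] by simp
  \<comment> \<open>The tangent space description of \<open>Yu\<close> gives this directly, without
    the spectral definition of the unstable space.\<close>
  then have "0 \<in> Yu"
    using zero_in_tangent_set[OF Wua(2), of "B1a_top a"] Wua(4) by (simp add: B1a_top_def)
  moreover have "norm_a1 a (0 :: real \<Rightarrow> real ^ 'n) = 0"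
    using deriv_on_constant[of "0 :: real \<Rightarrow> real ^ 'n"] by (simp add: norm_a1_def norm_a_def)
  ultimately have "0 \<in> Yeps" using eps by (simp add: Yeps)
  then have \<phi>0_Wu: "\<phi>0 \<in> w ` Yeps" using w(2) by force
  have a0: "a \<ge> 0" using a by simp

  \<comment> \<open>Assertion (i): solutions on the manifold and their decay\<close>
  have part1: "solution U f {..0} \<phi> \<and> limitin C1_top (\<lambda>s. seg s \<phi>) \<phi>0 at_bot \<and>
           (\<forall>s\<le>0. norm (\<phi> s - \<phi>0 0) \<le> cu * exp (\<beta> * s) * norm_a1 a (\<phi> - \<phi>0) \<and>
                   norm (deriv_on {..0} \<phi> s) \<le> cu * exp (\<beta> * s) * norm_a1 a (\<phi> - \<phi>0))"
    if "\<phi> \<in> Wu" for \<phi>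
  proof -
    have \<phi>: "\<phi> \<in> Wua" using that Wu_sub by auto
    have sol: "solution Ua fa {..0} \<phi>" by (rule Wua(5)[OF \<phi>])
    have seg_B: "seg s \<phi> \<in> B1a a" if "s \<le> 0" for s
      using sol that Ua_B by (auto simp: solution_def)
    have \<phi>C: "\<phi> \<in> Cont1 {..0}"
      using \<phi> Wua(1) unfolding Xa Ua solution_manifold_def by (auto simp: B1a_def)
    have 1: "solution U f {..0} \<phi>"
      using sol UaU by (auto simp: solution_def fa j1_def)
    have 2: "limitin C1_top (\<lambda>s. seg s \<phi>) \<phi>0 at_bot"
      unfolding limitin_def
    proof (intro conjI allI impI)
      show "\<phi>0 \<in> topspace C1_top" using C0 by (simp add: C1_top_def)
      fix G :: "(real \<Rightarrow> real ^ 'n) set" assume G: "openin C1_top G \<and> \<phi>0 \<in> G"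
      then obtain \<delta> where \<delta>: "\<delta> > 0" "\<forall>y\<in>B1a a. norm_a1 a (y - \<phi>0) < \<delta> \<longrightarrow> y \<in> G"
        using C1_top_B1a_nbhd[OF _ _ B0 a0] by blast
      obtain s0 where s0: "s0 \<le> 0" "\<forall>s\<le>s0. (cu * norm_a1 a (\<phi> - \<phi>0)) * exp (\<beta> * s) < \<delta>"
        using exp_at_bot_le[OF _ \<delta>(1)] rates by (metis order.strict_trans)
      have "seg s \<phi> \<in> G" if "s \<le> s0" for s
      proof -
        have "norm_a1 a (seg s \<phi> - \<phi>0) < \<delta>"
          using I[OF \<phi>, of s] s0 that by (force simp: mult_ac)
        then show ?thesis using \<delta>(2) seg_B[of s] s0(1) that by auto
      qed
      then show "\<forall>\<^sub>F s in at_bot. seg s \<phi> \<in> G"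
        by (auto simp: eventually_at_bot_linorder)
    qed
    have 3: "norm (\<phi> s - \<phi>0 0) \<le> cu * exp (\<beta> * s) * norm_a1 a (\<phi> - \<phi>0) \<and>
        norm (deriv_on {..0} \<phi> s) \<le> cu * exp (\<beta> * s) * norm_a1 a (\<phi> - \<phi>0)" if "s \<le> 0" for s
    proof -
      let ?\<eta> = "seg s \<phi> - \<phi>0"
      have \<eta>: "?\<eta> \<in> Ba a" "deriv_on {..0} ?\<eta> \<in> Ba a"
        using B1a_diff[OF seg_B[OF that] B0] by (auto simp: B1a_def)
      \<comment> \<open>The stationary point is constant and contributes no derivative.\<close>
      have "deriv_on {..0} ?\<eta> 0 = deriv_on {..0} \<phi> s"
        using Cont1_diff(2)[OF _ Cont1_seg(1)[OF \<phi>C that] C0] Cont1_seg(2)[OF \<phi>C that] D0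
        by (simp add: islimpt_atMost_real seg_def)
      moreover have "?\<eta> 0 = \<phi> s - \<phi>0 0" by (simp add: seg_def)
      \<comment> \<open>At \<open>t = 0\<close> the weight is \<open>1\<close>, so each value is
        bounded by its own summand of \<open>norm_a1 a\<close>; the other summand is
        nonnegative.\<close>
      ultimately have "norm (\<phi> s - \<phi>0 0) \<le> norm_a1 a ?\<eta>" "norm (deriv_on {..0} \<phi> s) \<le> norm_a1 a ?\<eta>"
        using \<eta>[THEN norm_a_nonneg] \<eta>[THEN norm_a_upper, of 0] by (simp_all add: norm_a1_def)
      then show ?thesis using I[OF \<phi> that] by linarith
    qed
    show ?thesis using 1 2 3 by blast
  qed

  \<comment> \<open>Assertion (ii): solutions with exponential decay enter the manifold\<close>
  have part2: "\<exists>s\<psi>\<le>0. \<forall>s\<le>s\<psi>. seg s \<psi> \<in> Wu"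
    if \<psi>: "\<psi> \<in> solution_manifold U f" and sol: "solution U f {..0} \<psi>"
      and bdd: "bdd_above ((\<lambda>s. exp (- \<gamma> * s) * norm (\<psi> s - \<phi>0 0)) ` {..0})"
      and bdd': "bdd_above ((\<lambda>s. exp (- \<gamma> * s) * norm (deriv_on {..0} \<psi> s)) ` {..0})" for \<psi>
  proof -
    have \<psi>C: "\<psi> \<in> Cont1 {..0}"
      using \<psi> openin_subset[OF U] by (auto simp: solution_manifold_def C1_top_def)
    obtain A where A: "exp (- \<gamma> * s) * norm (\<psi> s - \<phi>0 0) \<le> A" if "s \<le> 0" for s
      using bdd by (auto simp: bdd_above_def)
    obtain B where B: "exp (- \<gamma> * s) * norm (deriv_on {..0} \<psi> s) \<le> B" if "s \<le> 0" for s
      using bdd' by (auto simp: bdd_above_def)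
    have resc: "x \<le> K * exp (\<gamma> * s)" if "exp (- \<gamma> * s) * x \<le> K" for x K s
      using that by (simp add: exp_minus field_simps)
    have nonneg: "A \<ge> 0" "B \<ge> 0"
      using A[of 0] B[of 0] norm_ge_zero[of "\<psi> 0 - \<phi>0 0"] norm_ge_zero[of "deriv_on {..0} \<psi> 0"]
      by (simp_all del: norm_ge_zero)
    \<comment> \<open>For \<open>t \<le> 0\<close> the bound at time \<open>s + t\<close> is at most
      the one at time \<open>s\<close>, since \<open>\<gamma> > 0\<close> and \<open>A\<close>,
      \<open>B\<close> are nonnegative. Hence the difference and its derivative are uniformly
      bounded on the whole history, and \<open>B1a_bounded\<close> applies.\<close>
    have close: "seg s \<psi> - \<phi>0 \<in> B1a a" "norm_a1 a (seg s \<psi> - \<phi>0) \<le> (A + B) * exp (\<gamma> * s)"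
      if s: "s \<le> 0" for s
    proof -
      let ?\<eta> = "seg s \<psi> - \<phi>0"
      have \<eta>: "?\<eta> \<in> Cont1 {..0}" "deriv_on {..0} ?\<eta> = seg s (deriv_on {..0} \<psi>)"
        using Cont1_diff[OF _ Cont1_seg(1)[OF \<psi>C s] C0] Cont1_seg(2)[OF \<psi>C s] D0
        by (simp_all add: islimpt_atMost_real)
      have mono: "K * exp (\<gamma> * (s + t)) \<le> K * exp (\<gamma> * s)" if "K \<ge> 0" "t \<le> 0" for K t
        using that rates(2) by (intro mult_left_mono) auto
      have b1: "norm (?\<eta> t) \<le> A * exp (\<gamma> * s)" if "t \<le> 0" for t
        using resc[OF A[of "s + t"]] mono[OF nonneg(1) that] const[OF that] that s
        by (simp add: seg_def)
      have b2: "norm (deriv_on {..0} ?\<eta> t) \<le> B * exp (\<gamma> * s)" if "t \<le> 0" for t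
        using resc[OF B[of "s + t"]] mono[OF nonneg(2) that] that s
        unfolding \<eta>(2) by (simp add: seg_def)
      show "?\<eta> \<in> B1a a" "norm_a1 a ?\<eta> \<le> (A + B) * exp (\<gamma> * s)"
        using B1a_bounded[OF \<eta>(1) a0 b1 b2] by (simp_all add: distrib_right)
    qed
    \<comment> \<open>The sum of \<open>seg s \<psi> - \<phi>0\<close> and \<open>\<phi>0\<close> is
      written as a difference so that closure under differences yields the segment itself.\<close>
    have "0 - \<phi>0 \<in> B1a a" by (rule B1a_diff[OF zero_B B0])
    then have seg_B: "seg s \<psi> \<in> B1a a" if "s \<le> 0" for s
      using B1a_diff[OF close(1)[OF that]] by fastforce
    have ev: "\<exists>s0\<le>0. \<forall>s\<le>s0. norm_a1 a (seg s \<psi> - \<phi>0) < \<delta>" if \<delta>: "\<delta> > 0" for \<delta>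
    proof -
      obtain s0 where "s0 \<le> 0" "\<forall>s\<le>s0. (A + B) * exp (\<gamma> * s) < \<delta>"
        using exp_at_bot_le[OF rates(2) \<delta>] by blast
      then show ?thesis
        by (intro exI[of _ s0]) (force intro: le_less_trans[OF close(2)])
    qed
    obtain \<delta>1 where \<delta>1: "\<delta>1 > 0" "\<forall>y\<in>B1a a. norm_a1 a (y - \<phi>0) < \<delta>1 \<longrightarrow> y \<in> N"
      using C1_top_B1a_nbhd[OF N(1,3) B0 a0] by blast
    obtain \<delta>2 where \<delta>2: "\<delta>2 > 0" "\<forall>y\<in>B1a a. norm_a1 a (y - \<phi>0) < \<delta>2 \<longrightarrow> Rd1 d y \<in> Ud"
      using C1d_top_B1a_nbhd[OF Ud(1,2) B0 a0 d] by blast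
    \<comment> \<open>Both radii are needed: membership in \<open>Ua\<close> asks for the history to
      lie in \<open>N\<close> and for its restriction to lie in \<open>Ud\<close>.\<close>
    obtain s0 where s0: "s0 \<le> 0" "\<forall>s\<le>s0. norm_a1 a (seg s \<psi> - \<phi>0) < min \<delta>1 \<delta>2"
      using ev[of "min \<delta>1 \<delta>2"] \<delta>1(1) \<delta>2(1) by auto
    have inUa: "seg s \<psi> \<in> Ua" if "s \<le> s0" for s
    proof -
      have "s \<le> 0" using that s0(1) by linarith
      then show ?thesis
        using \<delta>1(2) \<delta>2(2) s0(2) seg_B that by (auto simp: Ua j1_def)
    qed
    \<comment> \<open>Segments of \<open>\<psi>\<close> at times after \<open>s0\<close> may leave
      \<open>Ua\<close>; those of the shifted history at times in \<open>{..0}\<close> all lie in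
      \<open>Ua\<close>, so (II) is applied to it.\<close>
    let ?\<chi> = "seg s0 \<psi>"
    have "solution Ua fa {..0} ?\<chi>"
      unfolding solution_def
    proof (intro ballI conjI)
      fix t :: real assume t: "t \<in> {..0}"
      then show "seg t ?\<chi> \<in> Ua" using inUa[of "s0 + t"] by (simp add: seg_seg)
      have "(\<psi> has_vector_derivative f (seg (s0 + t) \<psi>)) (at (s0 + t) within {..0})"
        using sol t s0(1) by (auto simp: solution_def)
      then show "(?\<chi> has_vector_derivative fa (seg t ?\<chi>)) (at t within {..0})"
        using t s0(1) by (auto simp: seg_seg fa j1_def intro: has_vector_derivative_seg)
    qed
    moreover have "bdd_above ((\<lambda>s. norm_a1 a (seg s ?\<chi> - \<phi>0) * exp (- \<gamma> * s)) ` {..0})"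
    proof (rule bdd_aboveI2)
      fix s :: real assume s: "s \<in> {..0}"
      \<comment> \<open>The shift keeps the rate \<open>\<gamma>\<close> and only multiplies the
        bound by \<open>exp (\<gamma> * s0)\<close>.\<close>
      have "norm_a1 a (seg s ?\<chi> - \<phi>0) * exp (- \<gamma> * s) \<le> (A + B) * exp (\<gamma> * (s0 + s)) * exp (- \<gamma> * s)"
        using s close(2)[of "s0 + s"] s0(1) by (intro mult_right_mono) (auto simp: seg_seg)
      also have "\<dots> = (A + B) * exp (\<gamma> * s0)"
        by (simp add: mult.assoc flip: exp_add) (simp add: algebra_simps)
      finally show "norm_a1 a (seg s ?\<chi> - \<phi>0) * exp (- \<gamma> * s) \<le> (A + B) * exp (\<gamma> * s0)" .
    qed
    ultimately obtain s1 where s1: "s1 \<le> 0" "\<forall>s\<le>s1. seg s ?\<chi> \<in> Wua"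
      using II[OF seg_B[OF s0(1)]] by blast
    obtain G where G: "openin (B1a_top a) G" "w ` Yeps = G \<inter> Wua"
      using w(3) unfolding openin_subtopology by auto
    obtain \<delta>3 where \<delta>3: "\<delta>3 > 0" "\<forall>y\<in>B1a a. norm_a1 a (y - \<phi>0) < \<delta>3 \<longrightarrow> y \<in> G"
      using B1a_top_nbhd[OF G(1)] \<phi>0_Wu G(2) by blast
    obtain s2 where s2: "s2 \<le> 0" "\<forall>s\<le>s2. norm_a1 a (seg s \<psi> - \<phi>0) < \<delta>3"
      using ev[OF \<delta>3(1)] by auto
    \<comment> \<open>The segment of \<open>\<psi>\<close> at \<open>s\<close> is that of
      \<open>?\<chi>\<close> at \<open>s - s0\<close>. The bound \<open>s0 + s1\<close> puts it into
      \<open>Wua\<close>, the bound \<open>s2\<close> into \<open>G\<close>, and \<open>Wu\<close>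
      is the intersection of the two.\<close>
    have "seg s \<psi> \<in> Wu" if s: "s \<le> min s2 (s0 + s1)" for s
    proof -
      have "seg (s - s0) ?\<chi> \<in> Wua" using s1(2) s by auto
      then have "seg s \<psi> \<in> Wua" using s s1(1) by (simp add: seg_seg)
      moreover have "seg s \<psi> \<in> G" using s s2 \<delta>3(2) seg_B[of s] by auto
      ultimately show ?thesis using G(2) by (auto simp: Wu(1) j1_def)
    qed
    then show ?thesis using s2(1) by (intro exI[of _ "min s2 (s0 + s1)"]) auto
  qed
  show ?thesis using part1 part2 by blast
qed

end
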